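(* Let $\Gamma$ be a finitely generated group and let $S$ be a finite symmetric generating set of $\Gamma$. Let $H_1,H_2$ be subgroups of $\Gamma$ and assume that $H_1$ is co-amenable in $\Gamma$. Then \[\sup_{g\in \Gamma} \rho\big(\Gamma/ (H_1\cap H_2^g)\big)= \rho(\Gamma/H_2),\] where $\rho$ denotes the co-spectral radius with respect to $S$.
   Context: For $g\in\Gamma$ and a subgroup $H\subset\Gamma$, $H^g:=g^{-1}Hg$. For a finite symmetric subset $S\subset\Gamma$ and a subgroup $H\subset \Gamma$, the co-spectral radius of $H$ (with respect to $S$) is the operator norm $\rho(\Gamma/H):=\|M\|$ of the operator $M\colon L^2(\Gamma/H)\to L^2(\Gamma/H)$ ($\Gamma/H$ carries counting measure) given by \[ M\phi(\gamma H)=\frac{1}{|S|}\sum_{s\in S}\phi(s\gamma H).\] A subgroup $H$ is called co-amenable in $\Gamma$ if its co-spectral radius equals $1$ for every choice of the finite symmetric subset $S$ (for finitely generated $\Gamma$ it is equivalent that it equals $1$ for some finite symmetric generating set). *)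

theory Defs
  imports
    "HOL-Analysis.Analysis"
    "HOL-Algebra.Left_Coset"
    "HOL-Algebra.Generated_Groups"
begin

text \<open>
  The space \<open>L\<^sup>2(X)\<close> for the counting measure on a set \<open>X\<close>. Functions are total on the
  ambient type; their values outside \<open>X\<close> are irrelevant to everything below.
\<close>

definition l2 :: "'x set \<Rightarrow> ('x \<Rightarrow> complex) set"
  where "l2 X = {\<phi>. (\<lambda>x. (cmod (\<phi> x))\<^sup>2) summable_on X}"

definition l2_norm :: "'x set \<Rightarrow> ('x \<Rightarrow> complex) \<Rightarrow> real"
  where "l2_norm X \<phi> = sqrt (\<Sum>\<^sub>\<infinity>x\<in>X. (cmod (\<phi> x))\<^sup>2)"

text \<open>
  As in the library's \<^const>\<open>onorm\<close>, functions of norm \<open>0\<close> contribute the quotient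
  \<open>0 / 0 = 0\<close>.
\<close>

definition l2_onorm :: "'x set \<Rightarrow> (('x \<Rightarrow> complex) \<Rightarrow> ('x \<Rightarrow> complex)) \<Rightarrow> real"
  where "l2_onorm X T = (SUP \<phi>\<in>l2 X. l2_norm X (T \<phi>) / l2_norm X \<phi>)"

definition finite_symmetric :: "('a, 'b) monoid_scheme \<Rightarrow> 'a set \<Rightarrow> bool"
  where "finite_symmetric G S \<longleftrightarrow>
    finite S \<and> S \<subseteq> carrier G \<and> (\<forall>s\<in>S. inv\<^bsub>G\<^esub> s \<in> S)"

definition conj_subgroup :: "('a, 'b) monoid_scheme \<Rightarrow> 'a set \<Rightarrow> 'a \<Rightarrow> 'a set"
  where "conj_subgroup G H g = (inv\<^bsub>G\<^esub> g <#\<^bsub>G\<^esub> H) #>\<^bsub>G\<^esub> g"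

text \<open>
  The argument \<open>C\<close> below stands for a left coset \<open>\<gamma>H\<close>, and the translate \<open>s <# C\<close> is the
  coset \<open>s\<gamma>H\<close>, independently of the representative \<open>\<gamma>\<close>; see the lemma
  \<open>averaging_operator_coset\<close>.
\<close>

definition averaging_operator ::
    "('a, 'b) monoid_scheme \<Rightarrow> 'a set \<Rightarrow> ('a set \<Rightarrow> complex) \<Rightarrow> ('a set \<Rightarrow> complex)"
  where "averaging_operator G S \<phi> C =
    1 / of_nat (card S) * (\<Sum>s\<in>S. \<phi> (s <#\<^bsub>G\<^esub> C))"

lemma (in group) averaging_operator_coset:
  assumes "S \<subseteq> carrier G" and "subgroup H G" and "\<gamma> \<in> carrier G"
  shows "averaging_operator G S \<phi> (\<gamma> <# H) =
    1 / of_nat (card S) * (\<Sum>s\<in>S. \<phi> ((s \<otimes> \<gamma>) <# H))"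
proof -
  have "s <# (\<gamma> <# H) = (s \<otimes> \<gamma>) <# H" if "s \<in> S" for s
    using assms that by (intro lcos_m_assoc) (auto dest: subgroup.subset)
  then show ?thesis
    unfolding averaging_operator_def by simp
qed

definition cospectral_radius ::
    "('a, 'b) monoid_scheme \<Rightarrow> 'a set \<Rightarrow> 'a set \<Rightarrow> real"
  where "cospectral_radius G S H = l2_onorm (lcosets\<^bsub>G\<^esub> H) (averaging_operator G S)"

text \<open>
  The condition \<open>S \<noteq> {}\<close> is implicit in the factor \<open>1 / |S|\<close>. It must be explicit here:
  with \<open>1 / 0 = 0\<close> the empty set has co-spectral radius \<open>0\<close>, so that no subgroup would be
  co-amenable.
\<close>

definition co_amenable :: "('a, 'b) monoid_scheme \<Rightarrow> 'a set \<Rightarrow> bool"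
  where "co_amenable G H \<longleftrightarrow>
    (\<forall>S. finite_symmetric G S \<and> S \<noteq> {} \<longrightarrow> cospectral_radius G S H = 1)"

end

theory Submission
  imports Defs
begin

text \<open>
  Write \<open>X = \<Gamma>/H\<^sub>1\<close>, \<open>Y = \<Gamma>/H\<^sub>2\<close> and \<open>\<rho>(Z)\<close> for the norm of the averaging operator \<open>M\<close> on \<open>L\<^sup>2(Z)\<close>,
  where \<open>Z\<close> is any set on which \<open>\<Gamma>\<close> acts.

  Upper bound. If \<open>p : Z \<rightarrow> Z'\<close> is equivariant, then \<open>\<rho>(Z) \<le> \<rho>(Z')\<close>: replace a function \<open>\<phi>\<close> on
  \<open>Z\<close> by the function \<open>\<psi>\<close> on \<open>Z'\<close> whose value at a point is the norm of \<open>\<phi>\<close> on the fibre over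
  that point. This keeps the norm, and Minkowski's inequality on each fibre shows that \<open>M\<psi>\<close>
  dominates the fibrewise norms of \<open>M\<phi>\<close> (lemma \<open>average_bound_equivariant_map\<close>). The map
  \<open>\<gamma>(H\<^sub>1 \<inter> H\<^sub>2\<^sup>g) \<mapsto> \<gamma>g\<inverse>H\<^sub>2\<close> is equivariant, so every term of the supremum is at most \<open>\<rho>(Y)\<close>
  (lemma \<open>cospectral_radius_le_of_subset_conj\<close>).

  Lower bound. Let \<open>R\<close> be the supremum. The stabiliser of the point \<open>(H\<^sub>1, g\<inverse>H\<^sub>2)\<close> of \<open>X \<times> Y\<close>
  is \<open>H\<^sub>1 \<inter> H\<^sub>2\<^sup>g\<close>, and every orbit of the diagonal action contains such a point. Hence
  \<open>L\<^sup>2(X \<times> Y)\<close> is an orthogonal sum of invariant subspaces on which \<open>M\<close> has norm at most \<open>R\<close>,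
  and \<open>\<rho>(X \<times> Y) \<le> R\<close> (lemma \<open>average_bound_lcosets_product\<close>). Co-amenability of \<open>H\<^sub>1\<close> yields
  unit vectors \<open>\<psi>\<close> in \<open>L\<^sup>2(X)\<close> that every \<open>s \<in> S\<close> moves by at most \<open>\<epsilon>\<close>
  (lemma \<open>co_amenable_almost_invariant\<close>). For such \<open>\<psi>\<close> and any \<open>\<phi>\<close> in \<open>L\<^sup>2(Y)\<close>, the vector
  \<open>M(\<psi> \<otimes> \<phi>)\<close> is within \<open>\<epsilon>\<parallel>\<phi>\<parallel>\<close> of \<open>\<psi> \<otimes> M\<phi>\<close>, so \<open>\<parallel>M\<phi>\<parallel> \<le> (R + \<epsilon>)\<parallel>\<phi>\<parallel>\<close>
  (lemma \<open>average_bound_of_product\<close>). Letting \<open>\<epsilon>\<close> tend to \<open>0\<close> gives \<open>\<rho>(Y) \<le> R\<close>.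
\<close>

section \<open>Square-summable functions\<close>

lemma l2_norm_nonneg [simp]: "0 \<le> l2_norm X \<phi>"
  by (simp add: l2_norm_def infsum_nonneg)

lemma l2_norm_power2: "(l2_norm X \<phi>)\<^sup>2 = (\<Sum>\<^sub>\<infinity>x\<in>X. (cmod (\<phi> x))\<^sup>2)"
  by (simp add: l2_norm_def infsum_nonneg)

lemma l2_has_sum: "\<phi> \<in> l2 X \<Longrightarrow> ((\<lambda>x. (cmod (\<phi> x))\<^sup>2) has_sum (l2_norm X \<phi>)\<^sup>2) X"
  by (simp add: l2_def l2_norm_power2)

lemma l2_norm_cong: "(\<And>x. x \<in> X \<Longrightarrow> cmod (\<phi> x) = cmod (\<psi> x)) \<Longrightarrow> l2_norm X \<phi> = l2_norm X \<psi>"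
  unfolding l2_norm_def by (simp cong: infsum_cong)

lemma l2_subset: "\<phi> \<in> l2 X \<Longrightarrow> A \<subseteq> X \<Longrightarrow> \<phi> \<in> l2 A"
  unfolding l2_def by (auto intro: summable_on_subset_banach)

lemma L2_set_le_l2_norm:
  assumes "\<phi> \<in> l2 X" "finite F" "F \<subseteq> X"
  shows "L2_set (\<lambda>x. cmod (\<phi> x)) F \<le> l2_norm X \<phi>"
  using assms unfolding L2_set_def l2_norm_def l2_def
  by (auto intro!: finite_sum_le_infsum)

text \<open>
  Together with the preceding lemma, this says that the norm of \<open>L\<^sup>2(X)\<close> is the supremum of the
  Euclidean norms over finite subsets. Minkowski's inequality thus passes from finite sets
  to \<open>X\<close>.
\<close>

lemma l2_norm_le_of_finite:
  assumes "\<And>F. finite F \<Longrightarrow> F \<subseteq> X \<Longrightarrow> L2_set (\<lambda>x. cmod (\<phi> x)) F \<le> B"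
  shows "\<phi> \<in> l2 X" and "l2_norm X \<phi> \<le> B"
proof -
  have B: "0 \<le> B"
    using assms[of "{}"] by simp
  have le: "(\<Sum>x\<in>F. (cmod (\<phi> x))\<^sup>2) \<le> B\<^sup>2" if "finite F" "F \<subseteq> X" for F
    using assms[OF that] unfolding L2_set_def by (rule sqrt_le_D)
  show mem: "\<phi> \<in> l2 X"
    using le unfolding l2_def by (auto intro!: nonneg_bdd_above_summable_on bdd_aboveI)
  have "(l2_norm X \<phi>)\<^sup>2 \<le> B\<^sup>2"
    using mem le unfolding l2_norm_power2 l2_def by (auto intro!: infsum_le_finite_sums)
  then show "l2_norm X \<phi> \<le> B"
    using B by (rule power2_le_imp_le)
qed

lemma l2_add:
  assumes "\<phi> \<in> l2 X" "\<psi> \<in> l2 X"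
  shows "(\<lambda>x. \<phi> x + \<psi> x) \<in> l2 X"
    and "l2_norm X (\<lambda>x. \<phi> x + \<psi> x) \<le> l2_norm X \<phi> + l2_norm X \<psi>"
proof -
  have *: "L2_set (\<lambda>x. cmod (\<phi> x + \<psi> x)) F \<le> l2_norm X \<phi> + l2_norm X \<psi>"
    if "finite F" "F \<subseteq> X" for F
  proof -
    have "L2_set (\<lambda>x. cmod (\<phi> x + \<psi> x)) F \<le> L2_set (\<lambda>x. cmod (\<phi> x) + cmod (\<psi> x)) F"
      by (intro L2_set_mono norm_triangle_ineq) auto
    also have "\<dots> \<le> L2_set (\<lambda>x. cmod (\<phi> x)) F + L2_set (\<lambda>x. cmod (\<psi> x)) F"
      by (rule L2_set_triangle_ineq)
    also have "\<dots> \<le> l2_norm X \<phi> + l2_norm X \<psi>"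
      using assms that by (intro add_mono L2_set_le_l2_norm)
    finally show ?thesis .
  qed
  show "(\<lambda>x. \<phi> x + \<psi> x) \<in> l2 X"
    and "l2_norm X (\<lambda>x. \<phi> x + \<psi> x) \<le> l2_norm X \<phi> + l2_norm X \<psi>"
    by (rule l2_norm_le_of_finite[OF *]; simp)+
qed

lemma l2_cmult:
  assumes "\<phi> \<in> l2 X"
  shows "(\<lambda>x. c * \<phi> x) \<in> l2 X" and "l2_norm X (\<lambda>x. c * \<phi> x) = cmod c * l2_norm X \<phi>"
  using assms unfolding l2_def l2_norm_def
  by (auto simp: norm_mult power_mult_distrib infsum_cmult_right' real_sqrt_mult
      intro: summable_on_cmult_right)

lemma l2_sum:
  assumes "finite S" and "\<And>s. s \<in> S \<Longrightarrow> f s \<in> l2 X"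
  shows "(\<lambda>x. \<Sum>s\<in>S. f s x) \<in> l2 X \<and>
    l2_norm X (\<lambda>x. \<Sum>s\<in>S. f s x) \<le> (\<Sum>s\<in>S. l2_norm X (f s))"
  using assms
proof (induction S rule: finite_induct)
  case empty
  then show ?case by (simp add: l2_def l2_norm_def)
next
  case (insert t S)
  then show ?case
    using l2_add[of "f t" X "\<lambda>x. \<Sum>s\<in>S. f s x"] by (auto intro: order_trans)
qed

lemma l2_reindex:
  assumes "bij_betw h X Y"
  shows "(\<lambda>x. \<phi> (h x)) \<in> l2 X \<longleftrightarrow> \<phi> \<in> l2 Y"
    and "l2_norm X (\<lambda>x. \<phi> (h x)) = l2_norm Y \<phi>"
  using summable_on_reindex_bij_betw[OF assms, of "\<lambda>y. (cmod (\<phi> y))\<^sup>2"]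
    infsum_reindex_bij_betw[OF assms, of "\<lambda>y. (cmod (\<phi> y))\<^sup>2"]
  unfolding l2_def l2_norm_def by auto

text \<open>
  Pythagoras for the partition of \<open>X\<close> into the fibres of \<open>p\<close>.
\<close>

lemma l2_fibres:
  assumes "\<phi> \<in> l2 X" and "\<And>x. x \<in> X \<Longrightarrow> p x \<in> Y"
  shows "((\<lambda>y. (l2_norm {x\<in>X. p x = y} \<phi>)\<^sup>2) has_sum (l2_norm X \<phi>)\<^sup>2) Y"
proof -
  let ?f = "\<lambda>x. (cmod (\<phi> x))\<^sup>2"
  have bij: "bij_betw snd (Sigma Y (\<lambda>y. {x\<in>X. p x = y})) X"
    using assms(2) by (auto simp: bij_betw_def inj_on_def image_iff)
  have "((\<lambda>z. ?f (snd z)) has_sum (l2_norm X \<phi>)\<^sup>2) (Sigma Y (\<lambda>y. {x\<in>X. p x = y}))"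
    using has_sum_reindex_bij_betw[OF bij, of ?f] l2_has_sum[OF assms(1)] by blast
  then show ?thesis
    by (rule has_sum_SigmaD) (use l2_subset[OF assms(1)] in \<open>auto intro!: l2_has_sum\<close>)
qed

lemma l2_tensor:
  assumes "\<psi> \<in> l2 X" "\<phi> \<in> l2 Y"
  shows "(\<lambda>(x, y). \<psi> x * \<phi> y) \<in> l2 (X \<times> Y)"
    and "l2_norm (X \<times> Y) (\<lambda>(x, y). \<psi> x * \<phi> y) = l2_norm X \<psi> * l2_norm Y \<phi>"
proof -
  let ?f = "\<lambda>z. (cmod (case z of (x, y) \<Rightarrow> \<psi> x * \<phi> y))\<^sup>2"
  have 1: "((\<lambda>y. ?f (x, y)) has_sum (cmod (\<psi> x))\<^sup>2 * (l2_norm Y \<phi>)\<^sup>2) Y" for x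
    using has_sum_cmult_right[OF l2_has_sum[OF assms(2)]]
    by (simp add: norm_mult power_mult_distrib)
  have 2: "((\<lambda>x. (cmod (\<psi> x))\<^sup>2 * (l2_norm Y \<phi>)\<^sup>2) has_sum
      (l2_norm X \<psi>)\<^sup>2 * (l2_norm Y \<phi>)\<^sup>2) X"
    by (rule has_sum_cmult_left[OF l2_has_sum[OF assms(1)]])
  have 3: "?f summable_on X \<times> Y"
    by (rule summable_on_SigmaI[OF 1]) (use 2 in \<open>auto simp: summable_on_def\<close>)
  then show "(\<lambda>(x, y). \<psi> x * \<phi> y) \<in> l2 (X \<times> Y)"
    by (simp add: l2_def)
  have "(?f has_sum (l2_norm X \<psi>)\<^sup>2 * (l2_norm Y \<phi>)\<^sup>2) (X \<times> Y)"
    by (rule has_sum_SigmaI[OF 1 2 3])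
  then have "(l2_norm (X \<times> Y) (\<lambda>(x, y). \<psi> x * \<phi> y))\<^sup>2 = (l2_norm X \<psi> * l2_norm Y \<phi>)\<^sup>2"
    unfolding l2_norm_power2 power_mult_distrib by (rule infsumI)
  then show "l2_norm (X \<times> Y) (\<lambda>(x, y). \<psi> x * \<phi> y) = l2_norm X \<psi> * l2_norm Y \<phi>"
    by (simp add: power2_eq_iff_nonneg)
qed

section \<open>Averaging over finitely many permutations\<close>

text \<open>
  The index set \<open>S\<close> acts on the points by arbitrary maps \<open>a s\<close>, so that one notion covers coset
  spaces, products of coset spaces and invariant subsets of them.
\<close>

definition average :: "'s set \<Rightarrow> ('s \<Rightarrow> 'x \<Rightarrow> 'x) \<Rightarrow> ('x \<Rightarrow> complex) \<Rightarrow> 'x \<Rightarrow> complex"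
  where "average S a \<phi> x = 1 / of_nat (card S) * (\<Sum>s\<in>S. \<phi> (a s x))"

text \<open>
  A one-sided form of ``the operator norm on \<open>L\<^sup>2(X)\<close> is at most \<open>R\<close>'', which avoids suprema.
\<close>

definition average_bound :: "'s set \<Rightarrow> ('s \<Rightarrow> 'x \<Rightarrow> 'x) \<Rightarrow> 'x set \<Rightarrow> real \<Rightarrow> bool"
  where "average_bound S a X R \<longleftrightarrow>
    (\<forall>\<phi>\<in>l2 X. l2_norm X (average S a \<phi>) \<le> R * l2_norm X \<phi>)"

lemma l2_mean:
  assumes "finite S" and "\<And>s. s \<in> S \<Longrightarrow> f s \<in> l2 X"
  shows "(\<lambda>x. 1 / of_nat (card S) * (\<Sum>s\<in>S. f s x)) \<in> l2 X"
    and "l2_norm X (\<lambda>x. 1 / of_nat (card S) * (\<Sum>s\<in>S. f s x)) \<le>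
      1 / real (card S) * (\<Sum>s\<in>S. l2_norm X (f s))"
proof -
  have mem: "(\<lambda>x. \<Sum>s\<in>S. f s x) \<in> l2 X"
    and le: "l2_norm X (\<lambda>x. \<Sum>s\<in>S. f s x) \<le> (\<Sum>s\<in>S. l2_norm X (f s))"
    using l2_sum[of S f X] assms by auto
  show "(\<lambda>x. 1 / of_nat (card S) * (\<Sum>s\<in>S. f s x)) \<in> l2 X"
    by (rule l2_cmult(1)[OF mem])
  show "l2_norm X (\<lambda>x. 1 / of_nat (card S) * (\<Sum>s\<in>S. f s x)) \<le>
      1 / real (card S) * (\<Sum>s\<in>S. l2_norm X (f s))"
    unfolding l2_cmult(2)[OF mem] using le by (simp add: norm_divide divide_right_mono)
qed

lemma mean_le:
  assumes "\<And>s. s \<in> S \<Longrightarrow> u s \<le> B" and "0 \<le> B"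
  shows "1 / real (card S) * (\<Sum>s\<in>S. u s) \<le> B"
proof (cases "card S = 0")
  case False
  then show ?thesis
    using sum_bounded_above[of S u B] assms(1) by (simp add: field_simps)
qed (use assms(2) in simp)

lemma average_l2:
  assumes "finite S" and "\<And>s. s \<in> S \<Longrightarrow> bij_betw (a s) X X" and "\<phi> \<in> l2 X"
  shows "average S a \<phi> \<in> l2 X" and "l2_norm X (average S a \<phi>) \<le> l2_norm X \<phi>"
proof -
  have eq: "average S a \<phi> = (\<lambda>x. 1 / of_nat (card S) * (\<Sum>s\<in>S. \<phi> (a s x)))"
    by (simp add: average_def fun_eq_iff)
  have mem: "(\<lambda>x. \<phi> (a s x)) \<in> l2 X" if "s \<in> S" for s
    using l2_reindex(1)[OF assms(2)[OF that]] assms(3) by simp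
  show "average S a \<phi> \<in> l2 X"
    unfolding eq by (rule l2_mean(1)[OF assms(1) mem])
  have "l2_norm X (average S a \<phi>) \<le> 1 / real (card S) * (\<Sum>s\<in>S. l2_norm X (\<lambda>x. \<phi> (a s x)))"
    unfolding eq by (rule l2_mean(2)[OF assms(1) mem])
  also have "\<dots> \<le> l2_norm X \<phi>"
    by (rule mean_le) (simp_all add: l2_reindex(2)[OF assms(2)])
  finally show "l2_norm X (average S a \<phi>) \<le> l2_norm X \<phi>" .
qed

lemma bij_betw_fibre:
  assumes f: "bij_betw f X X" and g: "bij_betw g Y Y"
    and p: "\<And>x. x \<in> X \<Longrightarrow> p x \<in> Y"
    and eqv: "\<And>x. x \<in> X \<Longrightarrow> p (f x) = g (p x)" and y: "y \<in> Y"
  shows "bij_betw f {x\<in>X. p x = y} {x\<in>X. p x = g y}"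
  unfolding bij_betw_def
proof
  show "inj_on f {x\<in>X. p x = y}"
    using f by (auto simp: bij_betw_def intro: inj_on_subset)
  show "f ` {x\<in>X. p x = y} = {x\<in>X. p x = g y}"
  proof (intro equalityI subsetI)
    fix x assume "x \<in> f ` {x\<in>X. p x = y}"
    then show "x \<in> {x\<in>X. p x = g y}"
      using eqv f by (auto simp: bij_betw_def)
  next
    fix x' assume x': "x' \<in> {x\<in>X. p x = g y}"
    then obtain x where x: "x \<in> X" "x' = f x"
      using f by (auto simp: bij_betw_def)
    then have "g (p x) = g y"
      using x' eqv by simp
    then have "p x = y"
      using g p[OF x(1)] y by (auto simp: bij_betw_def dest: inj_onD)
    then show "x' \<in> f ` {x\<in>X. p x = y}"
      using x by auto
  qed
qed

text \<open>
  Passing to a quotient can only increase the norm: a function on \<open>X\<close> is compared with the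
  nonnegative function on \<open>Y\<close> of its fibrewise norms. Each \<open>a s\<close> carries the fibre over \<open>y\<close>
  bijectively onto the fibre over \<open>b s y\<close>, so that averaging commutes with this comparison up to
  the triangle inequality.
\<close>

lemma average_bound_equivariant_map:
  fixes p :: "'x \<Rightarrow> 'y"
  assumes S: "finite S"
    and a: "\<And>s. s \<in> S \<Longrightarrow> bij_betw (a s) X X"
    and b: "\<And>s. s \<in> S \<Longrightarrow> bij_betw (b s) Y Y"
    and p: "\<And>x. x \<in> X \<Longrightarrow> p x \<in> Y"
    and eqv: "\<And>s x. s \<in> S \<Longrightarrow> x \<in> X \<Longrightarrow> p (a s x) = b s (p x)"
    and bound: "average_bound S b Y R" and R: "0 \<le> R"
  shows "average_bound S a X R"
  unfolding average_bound_def
proof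
  fix \<phi> assume \<phi>: "\<phi> \<in> l2 X"
  define fib where "fib y = {x\<in>X. p x = y}" for y
  define \<psi> where "\<psi> y = complex_of_real (l2_norm (fib y) \<phi>)" for y
  have sum\<psi>: "((\<lambda>y. (cmod (\<psi> y))\<^sup>2) has_sum (l2_norm X \<phi>)\<^sup>2) Y"
    using l2_fibres[OF \<phi> p] by (simp add: \<psi>_def fib_def)
  then have \<psi>: "\<psi> \<in> l2 Y"
    by (auto simp: l2_def summable_on_def)
  have norm\<psi>: "l2_norm Y \<psi> = l2_norm X \<phi>"
    using infsumI[OF sum\<psi>] l2_norm_power2[of Y \<psi>] by (simp add: power2_eq_iff_nonneg)
  have A\<psi>: "average S b \<psi> \<in> l2 Y"
    by (rule average_l2(1)[OF S b \<psi>])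
  have A\<phi>: "average S a \<phi> \<in> l2 X"
    by (rule average_l2(1)[OF S a \<phi>])
  have fibre_le: "l2_norm (fib y) (average S a \<phi>) \<le> cmod (average S b \<psi> y)" if y: "y \<in> Y" for y
  proof -
    have bij: "bij_betw (a s) (fib y) (fib (b s y))" if s: "s \<in> S" for s
      unfolding fib_def by (rule bij_betw_fibre[where p = p, OF a[OF s] b[OF s] p eqv[OF s] y])
    have mem: "(\<lambda>x. \<phi> (a s x)) \<in> l2 (fib y)" if "s \<in> S" for s
      using l2_reindex(1)[OF bij[OF that]] l2_subset[OF \<phi>] by (simp add: fib_def)
    have "l2_norm (fib y) (average S a \<phi>) \<le>
        1 / real (card S) * (\<Sum>s\<in>S. l2_norm (fib y) (\<lambda>x. \<phi> (a s x)))"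
      using l2_mean(2)[OF S mem] by (simp add: average_def[abs_def])
    also have "\<dots> = 1 / real (card S) * (\<Sum>s\<in>S. l2_norm (fib (b s y)) \<phi>)"
      by (simp add: l2_reindex(2)[OF bij])
    also have "\<dots> = cmod (average S b \<psi> y)"
    proof -
      have "average S b \<psi> y = of_real (1 / real (card S) * (\<Sum>s\<in>S. l2_norm (fib (b s y)) \<phi>))"
        by (simp add: average_def \<psi>_def)
      then show ?thesis
        by (simp only: norm_of_real) (simp add: sum_nonneg)
    qed
    finally show ?thesis .
  qed
  have "(l2_norm X (average S a \<phi>))\<^sup>2 \<le> (l2_norm Y (average S b \<psi>))\<^sup>2"
    by (rule has_sum_mono[OF l2_fibres[OF A\<phi> p] l2_has_sum[OF A\<psi>]])
      (use fibre_le in \<open>auto simp: fib_def intro!: power_mono\<close>)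
  then have "l2_norm X (average S a \<phi>) \<le> l2_norm Y (average S b \<psi>)"
    by (rule power2_le_imp_le) simp
  also have "\<dots> \<le> R * l2_norm X \<phi>"
    using bound \<psi> norm\<psi> by (auto simp: average_bound_def)
  finally show "l2_norm X (average S a \<phi>) \<le> R * l2_norm X \<phi>" .
qed

text \<open>
  The fibres of an invariant function \<open>q\<close> give an orthogonal decomposition of \<open>L\<^sup>2(X)\<close> that the
  averaging operator respects, so a bound on all pieces is a bound on the whole.
\<close>

lemma average_bound_decompose:
  assumes S: "finite S"
    and a: "\<And>s. s \<in> S \<Longrightarrow> bij_betw (a s) X X"
    and piece: "\<And>i. i \<in> q ` X \<Longrightarrow> average_bound S a {x\<in>X. q x = i} R"
    and R: "0 \<le> R"
  shows "average_bound S a X R"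
  unfolding average_bound_def
proof
  fix \<phi> assume \<phi>: "\<phi> \<in> l2 X"
  have "(l2_norm X (average S a \<phi>))\<^sup>2 \<le> R\<^sup>2 * (l2_norm X \<phi>)\<^sup>2"
  proof (rule has_sum_mono)
    show "((\<lambda>i. (l2_norm {x\<in>X. q x = i} (average S a \<phi>))\<^sup>2) has_sum
        (l2_norm X (average S a \<phi>))\<^sup>2) (q ` X)"
      by (rule l2_fibres[OF average_l2(1)[OF S a \<phi>]]) auto
    show "((\<lambda>i. R\<^sup>2 * (l2_norm {x\<in>X. q x = i} \<phi>)\<^sup>2) has_sum R\<^sup>2 * (l2_norm X \<phi>)\<^sup>2) (q ` X)"
      by (rule has_sum_cmult_right[OF l2_fibres[OF \<phi>]]) auto
    fix i assume "i \<in> q ` X"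
    then have "l2_norm {x\<in>X. q x = i} (average S a \<phi>) \<le> R * l2_norm {x\<in>X. q x = i} \<phi>"
      using piece l2_subset[OF \<phi>] by (auto simp: average_bound_def)
    then show "(l2_norm {x\<in>X. q x = i} (average S a \<phi>))\<^sup>2 \<le>
        R\<^sup>2 * (l2_norm {x\<in>X. q x = i} \<phi>)\<^sup>2"
      unfolding power_mult_distrib[symmetric] by (rule power_mono) simp
  qed
  then show "l2_norm X (average S a \<phi>) \<le> R * l2_norm X \<phi>"
    unfolding power_mult_distrib[symmetric] by (rule power2_le_imp_le) (simp add: R)
qed

text \<open>
  Tensoring with an almost invariant \<open>\<psi>\<close> embeds \<open>L\<^sup>2(Y)\<close> into \<open>L\<^sup>2(X \<times> Y)\<close> in a way that almost
  intertwines the averaging operators: pointwise,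
  \<open>\<psi>(x) (M\<phi>)(y) - M(\<psi> \<otimes> \<phi>)(x, y)\<close> is the mean over \<open>s\<close> of \<open>(\<psi>(x) - \<psi>(sx)) \<phi>(sy)\<close>, and each of
  these functions has norm at most \<open>\<epsilon> \<parallel>\<psi>\<parallel> \<parallel>\<phi>\<parallel>\<close>.
\<close>

lemma average_bound_of_product:
  assumes S: "finite S"
    and a: "\<And>s. s \<in> S \<Longrightarrow> bij_betw (a s) X X"
    and b: "\<And>s. s \<in> S \<Longrightarrow> bij_betw (b s) Y Y"
    and bound: "average_bound S (\<lambda>s (x, y). (a s x, b s y)) (X \<times> Y) R"
    and \<psi>: "\<psi> \<in> l2 X" "0 < l2_norm X \<psi>"
    and inv: "\<And>s. s \<in> S \<Longrightarrow> l2_norm X (\<lambda>x. \<psi> (a s x) - \<psi> x) \<le> \<epsilon> * l2_norm X \<psi>"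
    and \<epsilon>: "0 \<le> \<epsilon>"
  shows "average_bound S b Y (R + \<epsilon>)"
  unfolding average_bound_def
proof
  fix \<phi> assume \<phi>: "\<phi> \<in> l2 Y"
  let ?c = "\<lambda>s (x, y). (a s x, b s y)"
  define F where "F = (\<lambda>(x, y). \<psi> x * \<phi> y)"
  define E where "E s = (\<lambda>(x, y). (\<psi> x - \<psi> (a s x)) * \<phi> (b s y))" for s
  have F: "F \<in> l2 (X \<times> Y)" "l2_norm (X \<times> Y) F = l2_norm X \<psi> * l2_norm Y \<phi>"
    unfolding F_def by (rule l2_tensor[OF \<psi>(1) \<phi>])+
  have \<phi>b: "(\<lambda>y. \<phi> (b s y)) \<in> l2 Y" "l2_norm Y (\<lambda>y. \<phi> (b s y)) = l2_norm Y \<phi>" if "s \<in> S" for s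
    using l2_reindex[OF b[OF that]] \<phi> by auto
  have d: "(\<lambda>x. \<psi> x - \<psi> (a s x)) \<in> l2 X" if "s \<in> S" for s
    using l2_add(1)[OF \<psi>(1) l2_cmult(1)[of "\<lambda>x. \<psi> (a s x)" X "-1"]]
      l2_reindex(1)[OF a[OF that], of \<psi>] \<psi>(1) by simp
  have E: "E s \<in> l2 (X \<times> Y)" "l2_norm (X \<times> Y) (E s) \<le> \<epsilon> * l2_norm X \<psi> * l2_norm Y \<phi>"
    if s: "s \<in> S" for s
  proof -
    show "E s \<in> l2 (X \<times> Y)"
      unfolding E_def by (rule l2_tensor(1)[OF d[OF s] \<phi>b(1)[OF s]])
    have "l2_norm X (\<lambda>x. \<psi> x - \<psi> (a s x)) = l2_norm X (\<lambda>x. \<psi> (a s x) - \<psi> x)"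
      by (rule l2_norm_cong) (rule norm_minus_commute)
    then have "l2_norm (X \<times> Y) (E s) = l2_norm X (\<lambda>x. \<psi> (a s x) - \<psi> x) * l2_norm Y \<phi>"
      unfolding E_def l2_tensor(2)[OF d[OF s] \<phi>b(1)[OF s]] \<phi>b(2)[OF s] by simp
    then show "l2_norm (X \<times> Y) (E s) \<le> \<epsilon> * l2_norm X \<psi> * l2_norm Y \<phi>"
      using inv[OF s] by (simp add: mult_right_mono)
  qed
  have c: "bij_betw (?c s) (X \<times> Y) (X \<times> Y)" if "s \<in> S" for s
    using bij_betw_map_prod[OF a[OF that] b[OF that]] by (simp add: map_prod_def)
  have AF: "average S ?c F \<in> l2 (X \<times> Y)"
    by (rule average_l2(1)[OF S c F(1)])
  \<comment> \<open>Replacing \<open>\<psi> (a s x)\<close> by \<open>\<psi> x\<close> in each summand produces the error terms \<open>E s\<close>.\<close>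
  have split: "(\<lambda>(x, y). \<psi> x * average S b \<phi> y) =
      (\<lambda>z. average S ?c F z + 1 / of_nat (card S) * (\<Sum>s\<in>S. E s z))"
    by (auto simp: fun_eq_iff average_def F_def E_def sum.distrib[symmetric] sum_distrib_left
        algebra_simps diff_divide_distrib)
  have "l2_norm X \<psi> * l2_norm Y (average S b \<phi>) =
      l2_norm (X \<times> Y) (\<lambda>(x, y). \<psi> x * average S b \<phi> y)"
    by (rule l2_tensor(2)[symmetric, OF \<psi>(1) average_l2(1)[OF S b \<phi>]])
  also have "\<dots> \<le> l2_norm (X \<times> Y) (average S ?c F) +
      l2_norm (X \<times> Y) (\<lambda>z. 1 / of_nat (card S) * (\<Sum>s\<in>S. E s z))"
    unfolding split by (rule l2_add(2)[OF AF l2_mean(1)[of S E, OF S E(1)]])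
  also have "\<dots> \<le> R * (l2_norm X \<psi> * l2_norm Y \<phi>) + \<epsilon> * l2_norm X \<psi> * l2_norm Y \<phi>"
  proof (rule add_mono)
    show "l2_norm (X \<times> Y) (average S ?c F) \<le> R * (l2_norm X \<psi> * l2_norm Y \<phi>)"
      using bound F by (auto simp: average_bound_def)
    have "1 / real (card S) * (\<Sum>s\<in>S. l2_norm (X \<times> Y) (E s)) \<le> \<epsilon> * l2_norm X \<psi> * l2_norm Y \<phi>"
      by (rule mean_le[OF E(2)]) (simp_all add: \<epsilon>)
    then show "l2_norm (X \<times> Y) (\<lambda>z. 1 / of_nat (card S) * (\<Sum>s\<in>S. E s z)) \<le>
        \<epsilon> * l2_norm X \<psi> * l2_norm Y \<phi>"
      using l2_mean(2)[of S E, OF S E(1)] by linarith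
  qed
  also have "\<dots> = l2_norm X \<psi> * ((R + \<epsilon>) * l2_norm Y \<phi>)"
    by (simp add: algebra_simps)
  finally show "l2_norm Y (average S b \<phi>) \<le> (R + \<epsilon>) * l2_norm Y \<phi>"
    using \<psi>(2) by simp
qed

text \<open>
  The variance identity: the squared distances within a family add up, over ordered pairs, to
  twice the gap in the inequality of Cauchy and Schwarz for the sum of the family.
\<close>

lemma sum_sum_norm_diff_power2:
  fixes z :: "'s \<Rightarrow> 'v::real_inner"
  shows "(\<Sum>s\<in>S. \<Sum>t\<in>S. (norm (z s - z t))\<^sup>2) =
    2 * (real (card S) * (\<Sum>s\<in>S. (norm (z s))\<^sup>2) - (norm (\<Sum>s\<in>S. z s))\<^sup>2)"
proof -
  have "(\<Sum>s\<in>S. \<Sum>t\<in>S. (norm (z s - z t))\<^sup>2) =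
      (\<Sum>s\<in>S. \<Sum>t\<in>S. (norm (z s))\<^sup>2 + (norm (z t))\<^sup>2 - 2 * (z s \<bullet> z t))"
    by (intro sum.cong) (simp_all add: power2_norm_eq_inner inner_diff inner_commute)
  also have "\<dots> = 2 * (real (card S) * (\<Sum>s\<in>S. (norm (z s))\<^sup>2)) - 2 * (\<Sum>s\<in>S. \<Sum>t\<in>S. z s \<bullet> z t)"
    by (simp add: sum.distrib sum_subtractf sum_distrib_left)
  also have "(\<Sum>s\<in>S. \<Sum>t\<in>S. z s \<bullet> z t) = (norm (\<Sum>s\<in>S. z s))\<^sup>2"
    by (simp add: power2_norm_eq_inner inner_sum_left inner_sum_right inner_commute)
  finally show ?thesis by (simp add: algebra_simps)
qed

lemma norm_diff_power2_le_variance: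
  fixes z :: "'s \<Rightarrow> 'v::real_inner"
  assumes "finite S" "u \<in> S" "v \<in> S"
  shows "(norm (z u - z v))\<^sup>2 \<le>
    real (card S) * (\<Sum>s\<in>S. (norm (z s))\<^sup>2) - (norm (\<Sum>s\<in>S. z s))\<^sup>2"
proof (cases "u = v")
  case True
  have "0 \<le> (\<Sum>s\<in>S. \<Sum>t\<in>S. (norm (z s - z t))\<^sup>2)"
    by (simp add: sum_nonneg)
  then show ?thesis
    unfolding sum_sum_norm_diff_power2 using True by simp
next
  case False
  \<comment> \<open>The pair \<open>u, v\<close> is met twice, once in each order, which cancels the factor \<open>2\<close>.\<close>
  have "2 * (norm (z u - z v))\<^sup>2 = (\<Sum>(s, t)\<in>{(u, v), (v, u)}. (norm (z s - z t))\<^sup>2)"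
    using False by (simp add: norm_minus_commute)
  also have "\<dots> \<le> (\<Sum>(s, t)\<in>S \<times> S. (norm (z s - z t))\<^sup>2)"
    using assms by (intro sum_mono2) auto
  also have "\<dots> = 2 * (real (card S) * (\<Sum>s\<in>S. (norm (z s))\<^sup>2) - (norm (\<Sum>s\<in>S. z s))\<^sup>2)"
    by (simp add: sum.cartesian_product[symmetric] sum_sum_norm_diff_power2)
  finally show ?thesis by simp
qed

text \<open>
  If averaging hardly shrinks \<open>\<psi>\<close>, then the translates of \<open>\<psi>\<close> that are averaged nearly coincide.
  An index \<open>e\<close> that acts trivially makes \<open>\<psi>\<close> itself one of these translates.
\<close>

lemma almost_invariant_of_average:
  assumes S: "finite S"
    and a: "\<And>s. s \<in> S \<Longrightarrow> bij_betw (a s) X X"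
    and e: "e \<in> S" "\<And>x. x \<in> X \<Longrightarrow> a e x = x" and s: "s \<in> S"
    and \<psi>: "\<psi> \<in> l2 X"
  shows "(l2_norm X (\<lambda>x. \<psi> (a s x) - \<psi> x))\<^sup>2 \<le>
    (real (card S))\<^sup>2 * ((l2_norm X \<psi>)\<^sup>2 - (l2_norm X (average S a \<psi>))\<^sup>2)"
proof -
  let ?n = "real (card S)"
  have n: "?n \<noteq> 0"
    using S s by auto
  have A: "average S a \<psi> \<in> l2 X"
    by (rule average_l2(1)[OF S a \<psi>])
  have \<psi>a: "(\<lambda>x. \<psi> (a t x)) \<in> l2 X" "l2_norm X (\<lambda>x. \<psi> (a t x)) = l2_norm X \<psi>" if "t \<in> S" for t
    using l2_reindex[OF a[OF that]] \<psi> by auto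
  have d: "(\<lambda>x. \<psi> (a s x) - \<psi> x) \<in> l2 X"
    using l2_add(1)[OF \<psi>a(1)[OF s] l2_cmult(1)[OF \<psi>, of "-1"]] by simp
  have "((\<lambda>x. \<Sum>t\<in>T. (cmod (\<psi> (a t x)))\<^sup>2) has_sum (\<Sum>t\<in>T. (l2_norm X \<psi>)\<^sup>2)) X"
    if "finite T" "T \<subseteq> S" for T
    using that
  proof (induction T rule: finite_induct)
    case (insert t T)
    then show ?case
      using has_sum_add[OF l2_has_sum[OF \<psi>a(1)[of t]]] \<psi>a(2)[of t] by (simp add: distrib_right)
  qed simp
  from this[OF S order_refl] have 1: "((\<lambda>x. ?n * (\<Sum>t\<in>S. (cmod (\<psi> (a t x)))\<^sup>2)) has_sum ?n * (?n * (l2_norm X \<psi>)\<^sup>2)) X"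
    by (intro has_sum_cmult_right) simp
  have "(cmod (\<Sum>t\<in>S. \<psi> (a t x)))\<^sup>2 = ?n\<^sup>2 * (cmod (average S a \<psi> x))\<^sup>2" for x
    using n by (simp add: average_def norm_divide power_divide)
  then have 2: "((\<lambda>x. (cmod (\<Sum>t\<in>S. \<psi> (a t x)))\<^sup>2) has_sum
      ?n\<^sup>2 * (l2_norm X (average S a \<psi>))\<^sup>2) X"
    using has_sum_cmult_right[OF l2_has_sum[OF A], of "?n\<^sup>2"] by simp
  have 3: "((\<lambda>x. ?n * (\<Sum>t\<in>S. (cmod (\<psi> (a t x)))\<^sup>2) - (cmod (\<Sum>t\<in>S. \<psi> (a t x)))\<^sup>2) has_sum
      ?n * (?n * (l2_norm X \<psi>)\<^sup>2) - ?n\<^sup>2 * (l2_norm X (average S a \<psi>))\<^sup>2) X"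
    using has_sum_add[OF 1, of "\<lambda>x. - (cmod (\<Sum>t\<in>S. \<psi> (a t x)))\<^sup>2"
      "- (?n\<^sup>2 * (l2_norm X (average S a \<psi>))\<^sup>2)"] 2
    by (simp add: has_sum_uminus)
  have "(l2_norm X (\<lambda>x. \<psi> (a s x) - \<psi> x))\<^sup>2 \<le>
      ?n * (?n * (l2_norm X \<psi>)\<^sup>2) - ?n\<^sup>2 * (l2_norm X (average S a \<psi>))\<^sup>2"
  proof (rule has_sum_mono[OF l2_has_sum[OF d] 3])
    fix x assume "x \<in> X"
    then show "(cmod (\<psi> (a s x) - \<psi> x))\<^sup>2 \<le>
        ?n * (\<Sum>t\<in>S. (cmod (\<psi> (a t x)))\<^sup>2) - (cmod (\<Sum>t\<in>S. \<psi> (a t x)))\<^sup>2"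
      using norm_diff_power2_le_variance[OF S s e(1), of "\<lambda>t. \<psi> (a t x)"] e(2) by simp
  qed
  then show ?thesis
    by (simp add: power2_eq_square algebra_simps)
qed

section \<open>The co-spectral radius as an optimal bound\<close>

text \<open>
  The contraction hypothesis makes the supremum that defines the operator norm one of a bounded
  set. It also settles functions of norm \<open>0\<close>, on which the quotient carries no information.
\<close>

lemma
  assumes "\<And>\<phi>. \<phi> \<in> l2 X \<Longrightarrow> l2_norm X (T \<phi>) \<le> l2_norm X \<phi>"
  shows le_l2_onorm: "\<phi> \<in> l2 X \<Longrightarrow> l2_norm X (T \<phi>) \<le> l2_onorm X T * l2_norm X \<phi>"
    and l2_onorm_nonneg: "0 \<le> l2_onorm X T"
proof -
  have bdd: "bdd_above ((\<lambda>\<phi>. l2_norm X (T \<phi>) / l2_norm X \<phi>) ` l2 X)"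
    by (rule bdd_aboveI2[where M = 1]) (simp add: assms divide_le_eq_1 order_less_le)
  have le: "l2_norm X (T \<phi>) / l2_norm X \<phi> \<le> l2_onorm X T" if "\<phi> \<in> l2 X" for \<phi>
    unfolding l2_onorm_def by (rule cSUP_upper[OF that bdd])
  have zero: "(\<lambda>_. 0) \<in> l2 X"
    by (simp add: l2_def)
  show "0 \<le> l2_onorm X T"
    using le[OF zero] by (simp add: l2_norm_def)
  show "l2_norm X (T \<phi>) \<le> l2_onorm X T * l2_norm X \<phi>" if "\<phi> \<in> l2 X"
  proof (cases "l2_norm X \<phi> = 0")
    case True
    then show ?thesis
      using assms[OF that] by simp
  next
    case False
    then show ?thesis
      using le[OF that] by (simp add: pos_divide_le_eq order_less_le)
  qed
qed

lemma l2_onorm_le: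
  assumes "\<And>\<phi>. \<phi> \<in> l2 X \<Longrightarrow> l2_norm X (T \<phi>) \<le> R * l2_norm X \<phi>" and "0 \<le> R"
  shows "l2_onorm X T \<le> R"
  unfolding l2_onorm_def
proof (rule cSUP_least)
  have "(\<lambda>_. 0) \<in> l2 X"
    by (simp add: l2_def)
  then show "l2 X \<noteq> {}"
    by blast
  fix \<phi> assume "\<phi> \<in> l2 X"
  then show "l2_norm X (T \<phi>) / l2_norm X \<phi> \<le> R"
    using assms by (cases "l2_norm X \<phi> = 0") (simp_all add: pos_divide_le_eq order_less_le)
qed

lemma averaging_operator_eq_average: "averaging_operator G S = average S (\<lambda>s C. s <#\<^bsub>G\<^esub> C)"
  by (simp add: fun_eq_iff averaging_operator_def average_def)

context group
begin

lemma bij_betw_translate_lcosets: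
  assumes s: "s \<in> carrier G" and H: "H \<subseteq> carrier G"
  shows "bij_betw (\<lambda>C. s <# C) (lcosets H) (lcosets H)"
proof -
  have *: "t <# C \<in> lcosets H \<and> inv t <# (t <# C) = C"
    if t: "t \<in> carrier G" and C: "C \<in> lcosets H" for t C
  proof -
    obtain \<gamma> where \<gamma>: "\<gamma> \<in> carrier G" "C = \<gamma> <# H"
      using C by (auto simp: LCOSETS_def)
    then have tC: "t <# C = (t \<otimes> \<gamma>) <# H" and sub: "C \<subseteq> carrier G"
      using t H by (simp_all add: lcos_m_assoc l_coset_subset_G)
    have "inv t <# (t <# C) = C"
      using t sub by (simp add: lcos_m_assoc lcos_mult_one)
    then show ?thesis
      using t \<gamma>(1) tC by (auto simp: LCOSETS_def)
  qed
  show ?thesis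
    by (rule bij_betw_byWitness[where f' = "\<lambda>C. inv s <# C"])
      (use *[OF s] *[OF inv_closed[OF s]] s in auto)
qed

lemma
  assumes "finite S" "S \<subseteq> carrier G" "H \<subseteq> carrier G"
  shows average_bound_cospectral_radius:
      "average_bound S (\<lambda>s C. s <# C) (lcosets H) (cospectral_radius G S H)"
    and cospectral_radius_nonneg: "0 \<le> cospectral_radius G S H"
proof -
  have *: "l2_norm (lcosets H) (averaging_operator G S \<phi>) \<le> l2_norm (lcosets H) \<phi>"
    if "\<phi> \<in> l2 (lcosets H)" for \<phi>
    unfolding averaging_operator_eq_average
    by (rule average_l2(2)[OF assms(1) _ that])
      (use assms in \<open>auto intro!: bij_betw_translate_lcosets\<close>)
  show "average_bound S (\<lambda>s C. s <# C) (lcosets H) (cospectral_radius G S H)"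
    using le_l2_onorm[OF *]
    by (simp add: average_bound_def cospectral_radius_def averaging_operator_eq_average)
  show "0 \<le> cospectral_radius G S H"
    unfolding cospectral_radius_def by (rule l2_onorm_nonneg[OF *])
qed

lemma cospectral_radius_le:
  assumes "average_bound S (\<lambda>s C. s <# C) (lcosets H) R" and "0 \<le> R"
  shows "cospectral_radius G S H \<le> R"
  unfolding cospectral_radius_def averaging_operator_eq_average
  using assms by (intro l2_onorm_le) (auto simp: average_bound_def)

section \<open>Subgroups of conjugates\<close>

lemma mult_inv_cancel:
  assumes "x \<in> carrier G" "y \<in> carrier G"
  shows "x \<otimes> (inv x \<otimes> y) = y" and "inv x \<otimes> (x \<otimes> y) = y"
  using assms by (simp_all add: m_assoc[symmetric])

lemma mem_l_coset: "x \<in> \<gamma> <# A \<longleftrightarrow> (\<exists>a\<in>A. x = \<gamma> \<otimes> a)"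
  by (auto simp: l_coset_def)

lemma mem_conj_subgroup: "x \<in> conj_subgroup G H g \<longleftrightarrow> (\<exists>h\<in>H. x = inv g \<otimes> h \<otimes> g)"
  by (auto simp: conj_subgroup_def l_coset_def r_coset_def)

text \<open>
  For \<open>K \<le> H\<^sup>g\<close> the map \<open>\<gamma>K \<mapsto> \<gamma>g\<inverse>H\<close> is well defined because \<open>Kg\<inverse> \<subseteq> g\<inverse>H\<close>. Written as
  \<open>C \<mapsto> C g\<inverse> H\<close> it involves no choice of a representative.
\<close>

lemma cospectral_radius_le_of_subset_conj:
  assumes S: "finite S" "S \<subseteq> carrier G" and H: "subgroup H G" and g: "g \<in> carrier G"
    and K: "K \<subseteq> conj_subgroup G H g" "\<one> \<in> K"
  shows "cospectral_radius G S K \<le> cospectral_radius G S H"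
proof -
  have Hc: "H \<subseteq> carrier G"
    by (rule subgroup.subset[OF H])
  have Kc: "K \<subseteq> carrier G"
    using K(1) Hc g by (fastforce simp: mem_conj_subgroup)
  define p where "p C = (C #> inv g) <#> H" for C
  have p: "p (\<gamma> <# K) = (\<gamma> \<otimes> inv g) <# H" if \<gamma>: "\<gamma> \<in> carrier G" for \<gamma>
  proof (intro equalityI subsetI)
    fix x assume "x \<in> p (\<gamma> <# K)"
    then obtain k h where k: "k \<in> K" and h: "h \<in> H" and x: "x = \<gamma> \<otimes> k \<otimes> inv g \<otimes> h"
      by (auto simp: p_def set_mult_def r_coset_def l_coset_def)
    obtain h' where h': "h' \<in> H" "k = inv g \<otimes> h' \<otimes> g"
      using k K(1) mem_conj_subgroup by blast
    have "x = \<gamma> \<otimes> inv g \<otimes> (h' \<otimes> h)"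
      using x h h' g \<gamma> Hc by (simp add: m_assoc subset_iff mult_inv_cancel)
    then show "x \<in> (\<gamma> \<otimes> inv g) <# H"
      using h h' subgroup.m_closed[OF H] by (auto simp: mem_l_coset)
  next
    fix x assume "x \<in> (\<gamma> \<otimes> inv g) <# H"
    then obtain h where h: "h \<in> H" "x = \<gamma> \<otimes> \<one> \<otimes> inv g \<otimes> h"
      using \<gamma> by (auto simp: mem_l_coset)
    then show "x \<in> p (\<gamma> <# K)"
      using K(2) by (auto simp: p_def set_mult_def r_coset_def l_coset_def)
  qed
  have "average_bound S (\<lambda>s C. s <# C) (lcosets K) (cospectral_radius G S H)"
  proof (rule average_bound_equivariant_map[where p = p])
    show "finite S"
      by (rule S(1))
    show "bij_betw (\<lambda>C. s <# C) (lcosets K) (lcosets K)" if "s \<in> S" for s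
      using that S Kc by (auto intro: bij_betw_translate_lcosets)
    show "bij_betw (\<lambda>C. s <# C) (lcosets H) (lcosets H)" if "s \<in> S" for s
      using that S Hc by (auto intro: bij_betw_translate_lcosets)
    show "p C \<in> lcosets H" if "C \<in> lcosets K" for C
      using that p g by (auto simp: LCOSETS_def)
    show "p (s <# C) = s <# p C" if s: "s \<in> S" and C: "C \<in> lcosets K" for s C
    proof -
      obtain \<gamma> where \<gamma>: "\<gamma> \<in> carrier G" "C = \<gamma> <# K"
        using C by (auto simp: LCOSETS_def)
      have "p (s <# C) = p ((s \<otimes> \<gamma>) <# K)"
        using \<gamma> s S(2) Kc by (simp add: lcos_m_assoc subset_iff)
      also have "\<dots> = (s \<otimes> (\<gamma> \<otimes> inv g)) <# H"
        using \<gamma> s S(2) g by (simp add: p m_assoc subset_iff)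
      also have "\<dots> = s <# p C"
        using \<gamma> s S(2) g Hc by (simp add: p lcos_m_assoc subset_iff)
      finally show ?thesis .
    qed
  qed (use average_bound_cospectral_radius[OF S Hc] cospectral_radius_nonneg[OF S Hc] in auto)
  then show ?thesis
    by (rule cospectral_radius_le) (rule cospectral_radius_nonneg[OF S Hc])
qed

section \<open>The diagonal action on a product of coset spaces\<close>

text \<open>
  In the orbit of \<open>(H\<^sub>1, g\<inverse>H\<^sub>2)\<close>, the point \<open>(C, D)\<close> is recovered from the coset \<open>C \<inter> Dg\<close> of
  the stabiliser \<open>H\<^sub>1 \<inter> H\<^sub>2\<^sup>g\<close>. The lemma computes this coset at the point
  \<open>\<gamma>(H\<^sub>1, g\<inverse>H\<^sub>2)\<close> with \<open>\<gamma> = bg\<close>.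
\<close>

lemma l_coset_Int_conj:
  assumes "H\<^sub>1 \<subseteq> carrier G" "H\<^sub>2 \<subseteq> carrier G" "b \<in> carrier G" "g \<in> carrier G"
  shows "((b \<otimes> g) <# H\<^sub>1) \<inter> ((b <# H\<^sub>2) #> g) = (b \<otimes> g) <# (H\<^sub>1 \<inter> conj_subgroup G H\<^sub>2 g)"
proof (intro equalityI subsetI)
  fix x assume "x \<in> ((b \<otimes> g) <# H\<^sub>1) \<inter> ((b <# H\<^sub>2) #> g)"
  then obtain h k where h: "h \<in> H\<^sub>1" "x = b \<otimes> g \<otimes> h" and k: "k \<in> H\<^sub>2" "x = b \<otimes> k \<otimes> g"
    by (auto simp: l_coset_def r_coset_def)
  have "h = inv g \<otimes> k \<otimes> g"
  proof -
    have "b \<otimes> (g \<otimes> h) = b \<otimes> (k \<otimes> g)"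
      using h k assms by (simp add: m_assoc subset_iff)
    then have "g \<otimes> h = k \<otimes> g"
      using h k assms by (simp add: subset_iff)
    then show ?thesis
      using h k assms by (metis inv_solve_left m_assoc m_closed inv_closed subsetD)
  qed
  then have "h \<in> conj_subgroup G H\<^sub>2 g"
    using k(1) by (auto simp: mem_conj_subgroup)
  then show "x \<in> (b \<otimes> g) <# (H\<^sub>1 \<inter> conj_subgroup G H\<^sub>2 g)"
    using h by (auto simp: mem_l_coset)
next
  fix x assume "x \<in> (b \<otimes> g) <# (H\<^sub>1 \<inter> conj_subgroup G H\<^sub>2 g)"
  then obtain h k where h: "h \<in> H\<^sub>1" "x = b \<otimes> g \<otimes> h" and k: "k \<in> H\<^sub>2" "h = inv g \<otimes> k \<otimes> g"
    by (auto simp: mem_l_coset mem_conj_subgroup)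
  have "x = b \<otimes> k \<otimes> g"
    using h(2) k assms by (simp add: m_assoc subset_iff mult_inv_cancel)
  then have "x \<in> (b <# H\<^sub>2) #> g"
    using k(1) by (auto simp: l_coset_def r_coset_def)
  then show "x \<in> ((b \<otimes> g) <# H\<^sub>1) \<inter> ((b <# H\<^sub>2) #> g)"
    using h mem_l_coset by blast
qed

text \<open>
  The orbits of the diagonal action are told apart by the double coset
  \<open>C\<inverse>D = H\<^sub>1 a\<inverse>b H\<^sub>2\<close> of \<open>(C, D) = (aH\<^sub>1, bH\<^sub>2)\<close>, and \<open>(C, D) \<mapsto> C \<inter> Dg\<close> maps an orbit
  equivariantly to \<open>\<Gamma>/(H\<^sub>1 \<inter> H\<^sub>2\<^sup>g)\<close> for a suitable \<open>g\<close>.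
\<close>

lemma average_bound_lcosets_product:
  assumes S: "finite S" "S \<subseteq> carrier G" and H\<^sub>1: "subgroup H\<^sub>1 G" and H\<^sub>2: "subgroup H\<^sub>2 G"
    and R: "\<And>g. g \<in> carrier G \<Longrightarrow> cospectral_radius G S (H\<^sub>1 \<inter> conj_subgroup G H\<^sub>2 g) \<le> R"
  shows "average_bound S (\<lambda>s (C, D). (s <#\<^bsub>G\<^esub> C, s <#\<^bsub>G\<^esub> D)) ((lcosets H\<^sub>1) \<times> (lcosets H\<^sub>2)) R"
proof -
  let ?XY = "(lcosets H\<^sub>1) \<times> (lcosets H\<^sub>2)"
  let ?c = "\<lambda>s (C, D). (s <#\<^bsub>G\<^esub> C, s <#\<^bsub>G\<^esub> D)"
  have c1: "H\<^sub>1 \<subseteq> carrier G" and c2: "H\<^sub>2 \<subseteq> carrier G"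
    using H\<^sub>1 H\<^sub>2 by (simp_all add: subgroup.subset)
  define K where "K g = H\<^sub>1 \<inter> conj_subgroup G H\<^sub>2 g" for g
  have Kc: "K g \<subseteq> carrier G" for g
    using c1 by (auto simp: K_def)
  have R0: "0 \<le> R"
    using R[OF one_closed] cospectral_radius_nonneg[OF S Kc[of \<one>]] by (simp add: K_def)
  define q where "q = (\<lambda>(C, D). \<Union>c\<in>C. \<Union>d\<in>D. {inv c \<otimes> d})"
  have bij: "bij_betw (?c s) ?XY ?XY" if "s \<in> S" for s
    using bij_betw_map_prod[OF bij_betw_translate_lcosets bij_betw_translate_lcosets] that S(2) c1 c2
    by (auto simp: map_prod_def)
  have q_inv: "q (?c s z) = q z" if s: "s \<in> S" and z: "z \<in> ?XY" for s z
  proof -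
    obtain C D where z': "z = (C, D)" "C \<in> lcosets H\<^sub>1" "D \<in> lcosets H\<^sub>2"
      using z by auto
    have sub: "C \<subseteq> carrier G" "D \<subseteq> carrier G"
      using z' H\<^sub>1 H\<^sub>2 subgroup.lcosets_carrier[OF _ is_group] by blast+
    have "inv (s \<otimes> c) \<otimes> (s \<otimes> d) = inv c \<otimes> d" if "c \<in> C" "d \<in> D" for c d
      using that sub s S(2) by (simp add: inv_mult_group m_assoc subset_iff mult_inv_cancel)
    then show ?thesis
      by (simp add: z' q_def l_coset_def)
  qed
  show ?thesis
  proof (rule average_bound_decompose[OF S(1) bij, where q = q])
    fix i assume "i \<in> q ` ?XY"
    then obtain a\<^sub>0 b\<^sub>0 where 0: "a\<^sub>0 \<in> carrier G" "b\<^sub>0 \<in> carrier G"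
      and i: "i = q (a\<^sub>0 <# H\<^sub>1, b\<^sub>0 <# H\<^sub>2)"
      by (auto simp: LCOSETS_def)
    \<comment> \<open>Chosen so that \<open>a\<^sub>0 = b\<^sub>0g\<close>: the base point \<open>(a\<^sub>0H\<^sub>1, b\<^sub>0H\<^sub>2)\<close> is \<open>a\<^sub>0(H\<^sub>1, g\<inverse>H\<^sub>2)\<close>.\<close>
    define g where "g = inv b\<^sub>0 \<otimes> a\<^sub>0"
    have g: "g \<in> carrier G"
      using 0 by (simp add: g_def)
    define p where "p = (\<lambda>(C, D). C \<inter> (D #> g))"
    \<comment> \<open>Two points with the same double coset lie in one orbit.\<close>
    have rep: "\<exists>b\<in>carrier G. z = ((b \<otimes> g) <# H\<^sub>1, b <# H\<^sub>2)" if z: "z \<in> {z\<in>?XY. q z = i}" for z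
    proof -
      obtain a\<^sub>1 b\<^sub>1 where 1: "a\<^sub>1 \<in> carrier G" "b\<^sub>1 \<in> carrier G" "z = (a\<^sub>1 <# H\<^sub>1, b\<^sub>1 <# H\<^sub>2)"
        using z by (auto simp: LCOSETS_def)
      have "inv a\<^sub>0 \<otimes> b\<^sub>0 \<in> i"
        using 0 lcos_self[OF _ H\<^sub>1] lcos_self[OF _ H\<^sub>2] by (auto simp: i q_def)
      then obtain a b where ab: "a \<in> a\<^sub>1 <# H\<^sub>1" "b \<in> b\<^sub>1 <# H\<^sub>2" "inv a\<^sub>0 \<otimes> b\<^sub>0 = inv a \<otimes> b"
        using z 1 by (auto simp: q_def)
      have car: "a \<in> carrier G" "b \<in> carrier G"
        using ab 1 c1 c2 l_coset_subset_G by blast+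
      have "inv g = inv a \<otimes> b"
        using 0 ab(3) by (simp add: g_def inv_mult_group)
      then have "g = inv (inv a \<otimes> b)"
        using g inv_inv by metis
      then have "b \<otimes> g = a"
        using car by (simp add: inv_mult_group m_assoc[symmetric])
      moreover have "a\<^sub>1 <# H\<^sub>1 = a <# H\<^sub>1" "b\<^sub>1 <# H\<^sub>2 = b <# H\<^sub>2"
        by (rule l_repr_independence[OF ab(1) 1(1) H\<^sub>1], rule l_repr_independence[OF ab(2) 1(2) H\<^sub>2])
      ultimately show ?thesis
        using car 1 by auto
    qed
    have p: "p ((b \<otimes> g) <# H\<^sub>1, b <# H\<^sub>2) = (b \<otimes> g) <# K g" if "b \<in> carrier G" for b
      using l_coset_Int_conj[OF c1 c2 that g] by (simp add: p_def K_def)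
    show "average_bound S ?c {z\<in>?XY. q z = i} R"
    proof (rule average_bound_equivariant_map[where p = p])
      show "finite S"
        by (rule S(1))
      show "bij_betw (?c s) {z\<in>?XY. q z = i} {z\<in>?XY. q z = i}" if "s \<in> S" for s
        by (rule bij_betw_fibre[OF bij[OF that], where g = id and Y = UNIV and y = i, simplified])
          (use q_inv[OF that] in auto)
      show "bij_betw (\<lambda>C. s <# C) (lcosets K g) (lcosets K g)" if "s \<in> S" for s
        using that S Kc by (auto intro: bij_betw_translate_lcosets)
      show "p z \<in> lcosets K g" if "z \<in> {z\<in>?XY. q z = i}" for z
        using rep[OF that] p g by (auto simp: LCOSETS_def)
      show "p (?c s z) = s <# p z" if s: "s \<in> S" and z: "z \<in> {z\<in>?XY. q z = i}" for s z
      proof -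
        obtain b where b: "b \<in> carrier G" "z = ((b \<otimes> g) <# H\<^sub>1, b <# H\<^sub>2)"
          using rep[OF z] by blast
        have s': "s \<in> carrier G"
          using s S(2) by blast
        have "p (?c s z) = p ((s \<otimes> b \<otimes> g) <# H\<^sub>1, (s \<otimes> b) <# H\<^sub>2)"
          using b s' g c1 c2 by (simp add: lcos_m_assoc m_assoc)
        also have "\<dots> = (s \<otimes> b \<otimes> g) <# K g"
          using b s' by (simp add: p)
        also have "\<dots> = s <# p z"
          using b s' g Kc by (simp add: p lcos_m_assoc m_assoc)
        finally show ?thesis .
      qed
      show "average_bound S (\<lambda>s C. s <# C) (lcosets K g) R"
        unfolding average_bound_def
      proof
        fix \<phi> assume "\<phi> \<in> l2 (lcosets K g)"
        then have "l2_norm (lcosets K g) (average S (\<lambda>s C. s <# C) \<phi>) \<le>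
            cospectral_radius G S (K g) * l2_norm (lcosets K g) \<phi>"
          using average_bound_cospectral_radius[OF S Kc] by (auto simp: average_bound_def)
        also have "\<dots> \<le> R * l2_norm (lcosets K g) \<phi>"
          using R[OF g] by (intro mult_right_mono) (simp_all add: K_def)
        finally show "l2_norm (lcosets K g) (average S (\<lambda>s C. s <# C) \<phi>) \<le>
            R * l2_norm (lcosets K g) \<phi>" .
      qed
    qed (rule R0)
  qed (use q_inv R0 in auto)
qed

section \<open>Almost invariant vectors from co-amenability\<close>

text \<open>
  Co-amenability is applied to the set \<open>S \<union> {\<one>}\<close>: adding \<open>\<one>\<close> turns ``the translates of \<open>\<psi>\<close>
  nearly coincide'' into ``they are near \<open>\<psi>\<close>'', and it makes the set nonempty.
\<close>

lemma co_amenable_almost_invariant: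
  assumes S: "finite_symmetric G S" and H: "subgroup H G" "co_amenable G H" and \<epsilon>: "0 < \<epsilon>"
  obtains \<psi> where "\<psi> \<in> l2 (lcosets H)" "0 < l2_norm (lcosets H) \<psi>"
    "\<And>s. s \<in> S \<Longrightarrow>
      l2_norm (lcosets H) (\<lambda>C. \<psi> (s <#\<^bsub>G\<^esub> C) - \<psi> C) \<le> \<epsilon> * l2_norm (lcosets H) \<psi>"
proof -
  let ?X = "lcosets H" and ?T = "insert \<one> S"
  let ?A = "average ?T (\<lambda>s C. s <# C)"
  have T: "finite_symmetric G ?T" "finite ?T" "?T \<subseteq> carrier G"
    using S by (auto simp: finite_symmetric_def)
  have Hc: "H \<subseteq> carrier G"
    by (rule subgroup.subset[OF H(1)])
  have bij: "bij_betw (\<lambda>C. s <# C) ?X ?X" if "s \<in> ?T" for s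
    using that T(3) Hc by (auto intro: bij_betw_translate_lcosets)
  define n where "n = real (card ?T)"
  have n: "0 < n"
    using T(2) by (simp add: n_def card_gt_0_iff)
  \<comment> \<open>If averaging scales \<open>\<psi>\<close> by more than \<open>1 - \<delta>\<close>, then its relative displacement has square at
      most \<open>n\<^sup>2 (1 - (1 - \<delta>)\<^sup>2) \<le> 2 \<delta> n\<^sup>2\<close>, by \<open>almost_invariant_of_average\<close>.\<close>
  define \<delta> where "\<delta> = min 1 (\<epsilon>\<^sup>2 / (2 * n\<^sup>2))"
  have \<delta>: "0 < \<delta>" "\<delta> \<le> 1" "n\<^sup>2 * (2 * \<delta>) \<le> \<epsilon>\<^sup>2"
    using n \<epsilon> by (auto simp: \<delta>_def min_def field_simps)
  have "cospectral_radius G ?T H = 1"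
    using H(2) T(1) unfolding co_amenable_def by blast
  then have "\<not> average_bound ?T (\<lambda>s C. s <# C) ?X (1 - \<delta>)"
    using cospectral_radius_le[of ?T H "1 - \<delta>"] \<delta> by auto
  then obtain \<psi> where \<psi>: "\<psi> \<in> l2 ?X" and big: "(1 - \<delta>) * l2_norm ?X \<psi> < l2_norm ?X (?A \<psi>)"
    by (auto simp: average_bound_def not_le)
  have "l2_norm ?X (?A \<psi>) \<le> l2_norm ?X \<psi>"
    by (rule average_l2(2)[OF T(2) bij \<psi>])
  with big have "0 < \<delta> * l2_norm ?X \<psi>"
    by (simp add: algebra_simps)
  then have pos: "0 < l2_norm ?X \<psi>"
    using \<delta>(1) by (simp add: zero_less_mult_iff)
  have "l2_norm ?X (\<lambda>C. \<psi> (s <#\<^bsub>G\<^esub> C) - \<psi> C) \<le> \<epsilon> * l2_norm ?X \<psi>" if s: "s \<in> S" for s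
  proof (rule power2_le_imp_le)
    have one: "\<one> <# C = C" if "C \<in> ?X" for C
      using that subgroup.lcosets_carrier[OF H(1) is_group] by (simp add: lcos_mult_one)
    have "((1 - \<delta>) * l2_norm ?X \<psi>)\<^sup>2 \<le> (l2_norm ?X (?A \<psi>))\<^sup>2"
      using big \<delta> pos by (intro power_mono) auto
    moreover have "(1 - 2 * \<delta>) * (l2_norm ?X \<psi>)\<^sup>2 \<le> ((1 - \<delta>) * l2_norm ?X \<psi>)\<^sup>2"
      unfolding power_mult_distrib
      by (intro mult_right_mono) (simp_all add: power2_eq_square algebra_simps)
    ultimately have "(l2_norm ?X \<psi>)\<^sup>2 - (l2_norm ?X (?A \<psi>))\<^sup>2 \<le> 2 * \<delta> * (l2_norm ?X \<psi>)\<^sup>2"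
      by (simp add: algebra_simps)
    then have "n\<^sup>2 * ((l2_norm ?X \<psi>)\<^sup>2 - (l2_norm ?X (?A \<psi>))\<^sup>2) \<le>
        n\<^sup>2 * (2 * \<delta>) * (l2_norm ?X \<psi>)\<^sup>2"
      using n by (simp add: mult.assoc)
    also have "\<dots> \<le> \<epsilon>\<^sup>2 * (l2_norm ?X \<psi>)\<^sup>2"
      by (rule mult_right_mono[OF \<delta>(3)]) simp
    finally show "(l2_norm ?X (\<lambda>C. \<psi> (s <#\<^bsub>G\<^esub> C) - \<psi> C))\<^sup>2 \<le> (\<epsilon> * l2_norm ?X \<psi>)\<^sup>2"
      using almost_invariant_of_average[where a = "\<lambda>s C. s <#\<^bsub>G\<^esub> C" and e = \<one>, OF T(2) bij insertI1 one insertI2[OF s] \<psi>]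
      unfolding n_def power_mult_distrib by linarith
    show "0 \<le> \<epsilon> * l2_norm ?X \<psi>"
      using \<epsilon> by simp
  qed
  with \<psi> pos show ?thesis
    by (rule that)
qed

end

theorem theorem1p1:
  fixes G :: "('a, 'b) monoid_scheme" and S H\<^sub>1 H\<^sub>2 :: "'a set"
  assumes "group G"
    and "finite_symmetric G S"
    and "generate G S = carrier G"
    and "subgroup H\<^sub>1 G"
    and "subgroup H\<^sub>2 G"
    and "co_amenable G H\<^sub>1"
  shows "(SUP g\<in>carrier G. cospectral_radius G S (H\<^sub>1 \<inter> conj_subgroup G H\<^sub>2 g))
    = cospectral_radius G S H\<^sub>2"
proof -
  interpret group G by fact
  let ?\<rho> = "\<lambda>g. cospectral_radius G S (H\<^sub>1 \<inter> conj_subgroup G H\<^sub>2 g)"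
  define R where "R = (SUP g\<in>carrier G. ?\<rho> g)"
  have S: "finite S" "S \<subseteq> carrier G"
    using assms(2) by (auto simp: finite_symmetric_def)
  have c1: "H\<^sub>1 \<subseteq> carrier G" and c2: "H\<^sub>2 \<subseteq> carrier G"
    using assms(4,5) by (simp_all add: subgroup.subset)
  have upper: "?\<rho> g \<le> cospectral_radius G S H\<^sub>2" if g: "g \<in> carrier G" for g
  proof (rule cospectral_radius_le_of_subset_conj[OF S assms(5) g])
    have "\<one>\<^bsub>G\<^esub> \<in> conj_subgroup G H\<^sub>2 g"
      using g subgroup.one_closed[OF assms(5)] by (force simp: mem_conj_subgroup)
    then show "\<one>\<^bsub>G\<^esub> \<in> H\<^sub>1 \<inter> conj_subgroup G H\<^sub>2 g"
      using subgroup.one_closed[OF assms(4)] by simp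
  qed simp
  then have le_R: "?\<rho> g \<le> R" if "g \<in> carrier G" for g
    unfolding R_def using that by (intro cSUP_upper bdd_aboveI2)
  have R0: "0 \<le> R"
    by (rule order_trans[OF cospectral_radius_nonneg le_R[OF one_closed]]) (use S c1 in auto)
  have "cospectral_radius G S H\<^sub>2 \<le> R + \<epsilon>" if \<epsilon>: "0 < \<epsilon>" for \<epsilon>
  proof -
    obtain \<psi> where \<psi>: "\<psi> \<in> l2 (lcosets\<^bsub>G\<^esub> H\<^sub>1)" "0 < l2_norm (lcosets\<^bsub>G\<^esub> H\<^sub>1) \<psi>"
      "\<And>s. s \<in> S \<Longrightarrow>
        l2_norm (lcosets\<^bsub>G\<^esub> H\<^sub>1) (\<lambda>C. \<psi> (s <#\<^bsub>G\<^esub> C) - \<psi> C) \<le> \<epsilon> * l2_norm (lcosets\<^bsub>G\<^esub> H\<^sub>1) \<psi>"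
      using co_amenable_almost_invariant[OF assms(2,4,6) \<epsilon>] by blast
    have "average_bound S (\<lambda>s C. s <#\<^bsub>G\<^esub> C) (lcosets\<^bsub>G\<^esub> H\<^sub>2) (R + \<epsilon>)"
    proof (rule average_bound_of_product[OF S(1) _ _ _ \<psi>])
      show "average_bound S (\<lambda>s (C, D). (s <#\<^bsub>G\<^esub> C, s <#\<^bsub>G\<^esub> D)) ((lcosets\<^bsub>G\<^esub> H\<^sub>1) \<times> (lcosets\<^bsub>G\<^esub> H\<^sub>2)) R"
        by (rule average_bound_lcosets_product[OF S assms(4,5) le_R])
    qed (use S c1 c2 \<epsilon> in \<open>auto intro: bij_betw_translate_lcosets\<close>)
    then show ?thesis
      by (rule cospectral_radius_le) (use R0 \<epsilon> in simp)
  qed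
  then have "cospectral_radius G S H\<^sub>2 \<le> R"
    by (rule field_le_epsilon)
  moreover have "R \<le> cospectral_radius G S H\<^sub>2"
    unfolding R_def using upper by (intro cSUP_least) auto
  ultimately show ?thesis
    unfolding R_def by simp
qed

end
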